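(* Let $p$ be a prime with $p\equiv1\pmod4$. Then $$\sum_{k=0}^{p-1}\frac{\binom{2k}k\binom{4k}{2k}}{64^k}\cdot\frac p{4k+1}\equiv(-1)^{\frac{p-1}4}\frac{3-2^{p-1}}2\binom{\frac{p-1}2}{\frac{p-1}4}\pmod{p^2}.$$
   Context: Congruences are taken in the ring $\mathbb Z_p$ of rational numbers whose denominators are not divisible by $p$. *)

theory Defs
  imports Complex_Main "HOL-Computational_Algebra.Primes"
begin

text \<open>The ring of rational numbers whose denominators are not divisible by \<open>p\<close>.
  \<open>quotient_of\<close> returns the fraction in lowest terms, with positive denominator.\<close>

definition p_integral :: "nat \<Rightarrow> rat set" where
  "p_integral p = {x. \<not> int p dvd snd (quotient_of x)}"

text \<open>Congruence modulo \<open>m\<close> in that ring. Both sides are required to lie in the ring, and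
  the quotient \<open>c\<close> is taken in the ring, not in \<open>rat\<close>, where divisibility would be trivial.\<close>

definition pcong :: "nat \<Rightarrow> rat \<Rightarrow> rat \<Rightarrow> rat \<Rightarrow> bool" where
  "pcong p m x y \<longleftrightarrow>
     x \<in> p_integral p \<and> y \<in> p_integral p \<and> (\<exists>c \<in> p_integral p. x - y = m * c)"

end

theory Submission
  imports Defs "HOL-Computational_Algebra.Formal_Power_Series"
begin

text \<open>
  Write \<open>p = 4 n + 1\<close>. The coefficient of the \<open>k\<close>-th term is \<open>(1/4)\<^sub>k (3/4)\<^sub>k / k!\<^sup>2\<close>, and
  \<open>4 k + 1\<close> is divisible by \<open>p\<close> only for \<open>k = n\<close>. The terms with \<open>k > n\<close> vanish modulo \<open>p\<^sup>2\<close>;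
  for \<open>k < n\<close> it is enough to know the coefficient modulo \<open>p\<close>, where it is
  \<open>c k = (-1)^k (n choose k) (n + k choose k)\<close>. The partial fraction expansion of
  \<open>(1 - z) \<dots> (n - z) / (z (z + 1) \<dots> (z + n))\<close> has the residues \<open>c k\<close>, so its value at \<open>z = 1/4\<close>
  gives \<open>\<Sum>k\<le>n. c k p / (4 k + 1) = (3/4)\<^sub>n / (1/4)\<^sub>n\<close>. Put \<open>D = c n\<close>,
  \<open>P = \<Prod>j=1..n. 1 - p / (4 (n + j))\<close> and \<open>Q = \<Prod>j=1..n. 1 - p / (4 j)\<close>. Then the whole sum is
  congruent to \<open>D (P / Q + P Q - 1)\<close>, in which the first-order term of \<open>Q\<close> cancels, leaving
  \<open>D (1 - (p / 2) (1 / (n + 1) + \<dots> + 1 / (2 n)))\<close>. The inner sum is the alternating harmonic sum up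
  to \<open>2 n = (p - 1) / 2\<close>, which is the Fermat quotient \<open>(2 ^ (p - 1) - 1) / p\<close> modulo \<open>p\<close>.
\<close>

section \<open>The ring of p-integral rationals\<close>

text \<open>The reduced denominator divides the denominator of every other representation, so
  closure properties can be proved with arbitrary fractions instead of lowest terms.\<close>

lemma p_integral_iff:
  "x \<in> p_integral p \<longleftrightarrow> (\<exists>a b. \<not> int p dvd b \<and> x = of_int a / of_int b)"
proof
  assume "x \<in> p_integral p"
  then show "\<exists>a b. \<not> int p dvd b \<and> x = of_int a / of_int b"
    unfolding p_integral_def
    by (metis (mono_tags, lifting) mem_Collect_eq quotient_of_div surjective_pairing)
next
  assume "\<exists>a b. \<not> int p dvd b \<and> x = of_int a / of_int b"
  then obtain a b where b: "\<not> int p dvd b" and x: "x = of_int a / of_int b"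
    by blast
  obtain c d where q: "quotient_of x = (c, d)"
    by fastforce
  have d: "d > 0" and cop: "coprime c d" and xcd: "x = of_int c / of_int d"
    using quotient_of_denom_pos[OF q] quotient_of_coprime[OF q] quotient_of_div[OF q] by auto
  have "b \<noteq> 0"
    using b by auto
  then have "(of_int (c * b) :: rat) = of_int (a * d)"
    using x xcd d by (simp add: field_simps)
  then have "c * b = a * d"
    by linarith
  then have "d dvd c * b"
    by simp
  then have "d dvd b"
    using cop by (simp add: coprime_commute coprime_dvd_mult_right_iff)
  then have "\<not> int p dvd d"
    using b dvd_trans by blast
  then show "x \<in> p_integral p"
    by (simp add: p_integral_def q)
qed

context
  fixes p :: nat
  assumes p: "prime p"
begin

lemma p_integral_of_int: "of_int a \<in> p_integral p"
  unfolding p_integral_iff using p prime_gt_1_nat by (intro exI[of _ a] exI[of _ 1]) auto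

lemma p_integral_of_nat: "of_nat a \<in> p_integral p"
  using p_integral_of_int[of "int a"] by simp

lemma p_integral_numeral: "numeral a \<in> p_integral p"
  using p_integral_of_nat[of "numeral a"] by simp

lemma p_integral_0: "0 \<in> p_integral p"
  using p_integral_of_nat[of 0] by simp

lemma p_integral_1: "1 \<in> p_integral p"
  using p_integral_of_nat[of 1] by simp

lemma p_integral_mult:
  assumes "x \<in> p_integral p" "y \<in> p_integral p"
  shows "x * y \<in> p_integral p"
proof -
  obtain a b c d where "\<not> int p dvd b" "\<not> int p dvd d"
    and "x = of_int a / of_int b" "y = of_int c / of_int d"
    using assms unfolding p_integral_iff by blast
  then show ?thesis
    unfolding p_integral_iff using p
    by (intro exI[of _ "a * c"] exI[of _ "b * d"]) (auto simp: prime_dvd_mult_iff)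
qed

lemma p_integral_add:
  assumes "x \<in> p_integral p" "y \<in> p_integral p"
  shows "x + y \<in> p_integral p"
proof -
  obtain a b c d where *: "\<not> int p dvd b" "\<not> int p dvd d"
    and "x = of_int a / of_int b" "y = of_int c / of_int d"
    using assms unfolding p_integral_iff by blast
  moreover have "b \<noteq> 0" "d \<noteq> 0"
    using * by auto
  ultimately show ?thesis
    unfolding p_integral_iff using p
    by (intro exI[of _ "a * d + c * b"] exI[of _ "b * d"])
       (auto simp: prime_dvd_mult_iff field_simps)
qed

lemma p_integral_minus: "x \<in> p_integral p \<Longrightarrow> - x \<in> p_integral p"
  using p_integral_mult[OF p_integral_of_int[of "- 1"]] by fastforce

lemma p_integral_diff:
  "x \<in> p_integral p \<Longrightarrow> y \<in> p_integral p \<Longrightarrow> x - y \<in> p_integral p"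
  using p_integral_add[of x "- y"] p_integral_minus[of y] by simp

lemma p_integral_power: "x \<in> p_integral p \<Longrightarrow> x ^ k \<in> p_integral p"
  by (induction k) (auto intro: p_integral_1 p_integral_mult)

lemma p_integral_sum: "(\<And>i. i \<in> A \<Longrightarrow> f i \<in> p_integral p) \<Longrightarrow> sum f A \<in> p_integral p"
  by (induction A rule: infinite_finite_induct) (auto intro: p_integral_0 p_integral_add)

lemma p_integral_prod: "(\<And>i. i \<in> A \<Longrightarrow> f i \<in> p_integral p) \<Longrightarrow> prod f A \<in> p_integral p"
  by (induction A rule: infinite_finite_induct) (auto intro: p_integral_1 p_integral_mult)

lemmas p_integral_intros = p_integral_0 p_integral_1 p_integral_numeral p_integral_of_nat
  p_integral_of_int p_integral_add p_integral_diff p_integral_minus p_integral_mult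
  p_integral_power p_integral_sum p_integral_prod

lemma p_integral_divide_int:
  "x \<in> p_integral p \<Longrightarrow> \<not> int p dvd b \<Longrightarrow> x / of_int b \<in> p_integral p"
  using p_integral_mult[of x "1 / of_int b"] p_integral_iff[of "1 / of_int b"]
  by (metis mult.right_neutral of_int_1 times_divide_eq_right)

lemma p_integral_divide_nat:
  "x \<in> p_integral p \<Longrightarrow> \<not> p dvd b \<Longrightarrow> x / of_nat b \<in> p_integral p"
  using p_integral_divide_int[of x "int b"] by simp

section \<open>Congruence calculus\<close>

lemma pcongI: "x \<in> p_integral p \<Longrightarrow> y \<in> p_integral p \<Longrightarrow> c \<in> p_integral p \<Longrightarrow> x - y = m * c
  \<Longrightarrow> pcong p m x y"
  unfolding pcong_def by blast

lemma pcong_refl: "x \<in> p_integral p \<Longrightarrow> pcong p m x x"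
  by (rule pcongI[of _ _ 0]) (auto intro: p_integral_0)

lemma pcong_sym: "pcong p m x y \<Longrightarrow> pcong p m y x"
  unfolding pcong_def by (metis minus_diff_eq mult_minus_right p_integral_minus)

lemma pcong_trans [trans]:
  assumes "pcong p m x y" "pcong p m y z"
  shows "pcong p m x z"
proof -
  obtain c d where "c \<in> p_integral p" "d \<in> p_integral p" "x - y = m * c" "y - z = m * d"
    using assms unfolding pcong_def by blast
  then show ?thesis
    using assms by (intro pcongI[of _ _ "c + d"]) (auto simp: pcong_def algebra_simps intro: p_integral_intros)
qed

lemma pcong_add:
  assumes "pcong p m x y" "pcong p m x' y'"
  shows "pcong p m (x + x') (y + y')"
proof -
  obtain c d where "c \<in> p_integral p" "d \<in> p_integral p" "x - y = m * c" "x' - y' = m * d"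
    using assms unfolding pcong_def by blast
  moreover from this have "x + x' - (y + y') = m * (c + d)"
    by (simp add: algebra_simps)
  ultimately show ?thesis
    using assms by (intro pcongI[of _ _ "c + d"]) (auto simp: pcong_def intro: p_integral_intros)
qed

lemma pcong_mult:
  assumes "pcong p m x y" "pcong p m x' y'"
  shows "pcong p m (x * x') (y * y')"
proof -
  obtain c d where cd: "c \<in> p_integral p" "d \<in> p_integral p" "x - y = m * c" "x' - y' = m * d"
    using assms unfolding pcong_def by blast
  have "x * x' - y * y' = x * (x' - y') + (x - y) * y'"
    by (simp add: algebra_simps)
  also have "\<dots> = m * (x * d + c * y')"
    unfolding cd by (simp add: algebra_simps)
  finally show ?thesis
    using assms cd by (intro pcongI[of _ _ "x * d + c * y'"]) (auto simp: pcong_def intro: p_integral_intros)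
qed


lemma pcong_scale: "z \<in> p_integral p \<Longrightarrow> pcong p m x y \<Longrightarrow> pcong p m (z * x) (z * y)"
  by (intro pcong_mult pcong_refl)

lemma pcong_minus: "pcong p m x y \<Longrightarrow> pcong p m (- x) (- y)"
  using pcong_scale[of "- 1" m x y] by (simp add: p_integral_minus p_integral_1)

lemma pcong_diff:
  "pcong p m x y \<Longrightarrow> pcong p m x' y' \<Longrightarrow> pcong p m (x - x') (y - y')"
  using pcong_add[of m x y "- x'" "- y'"] pcong_minus[of m x' y'] by simp

lemma pcong_sum: "(\<And>i. i \<in> A \<Longrightarrow> pcong p m (f i) (g i)) \<Longrightarrow> pcong p m (sum f A) (sum g A)"
  by (induction A rule: infinite_finite_induct) (auto intro: pcong_add pcong_refl p_integral_0)

lemma pcong_prod: "(\<And>i. i \<in> A \<Longrightarrow> pcong p m (f i) (g i)) \<Longrightarrow> pcong p m (prod f A) (prod g A)"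
  by (induction A rule: infinite_finite_induct) (auto intro: pcong_mult pcong_refl p_integral_1)

text \<open>An explicit factor \<open>p\<close> raises the modulus: this is why most coefficients
  are needed only modulo \<open>p\<close>.\<close>

lemma pcong_p_square:
  assumes "pcong p (of_nat p) x y"
  shows "pcong p (of_nat p ^ 2) (of_nat p * x) (of_nat p * y)"
proof -
  obtain c where c: "c \<in> p_integral p" "x - y = of_nat p * c"
    using assms unfolding pcong_def by blast
  have "of_nat p * x - of_nat p * y = of_nat p * (x - y)"
    by (simp add: algebra_simps)
  also have "\<dots> = of_nat p ^ 2 * c"
    unfolding c by (simp add: power2_eq_square)
  finally show ?thesis
    using assms c(1) by (intro pcongI[of _ _ c] p_integral_mult) (auto simp: pcong_def intro: p_integral_intros)
qed

text \<open>Linearisation in \<open>p\<close>: every product of two terms \<open>p * v i\<close>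
  already carries \<open>p ^ 2\<close>.\<close>

lemma prod_one_plus_p:
  assumes "\<And>i. i \<in> A \<Longrightarrow> v i \<in> p_integral p"
  shows "pcong p (of_nat p ^ 2) (\<Prod>i\<in>A. 1 + of_nat p * v i) (1 + of_nat p * (\<Sum>i\<in>A. v i))"
  using assms
proof (induction A rule: infinite_finite_induct)
  case (insert i A)
  let ?s = "\<Sum>i\<in>A. v i"
  have R: "v i \<in> p_integral p" "?s \<in> p_integral p"
    using insert by (auto intro: p_integral_intros)
  have "pcong p (of_nat p ^ 2) ((1 + of_nat p * v i) * (\<Prod>i\<in>A. 1 + of_nat p * v i))
    ((1 + of_nat p * v i) * (1 + of_nat p * ?s))"
    using insert R by (intro pcong_scale p_integral_intros) auto
  also have "pcong p (of_nat p ^ 2) \<dots> (1 + of_nat p * (v i + ?s))"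
  proof (rule pcongI[of _ _ "v i * ?s"])
    show "(1 + of_nat p * v i) * (1 + of_nat p * ?s) - (1 + of_nat p * (v i + ?s))
        = of_nat p ^ 2 * (v i * ?s)"
      by (simp add: algebra_simps power2_eq_square)
  qed (use R in \<open>auto intro: p_integral_intros\<close>)
  finally show ?case
    using insert by simp
qed (auto intro: pcong_refl p_integral_1)

section \<open>The Fermat quotient of 2\<close>

text \<open>Neighbours in row \<open>p - 1\<close> of Pascal's triangle add up to an inner entry of
  row \<open>p\<close>, which is divisible by \<open>p\<close>; so the entries alternate in sign,
  starting from 1.\<close>

lemma pcong_choose_pred:
  "k < p \<Longrightarrow> pcong p (of_nat p) (of_nat ((p - 1) choose k)) ((- 1) ^ k)"
proof (induction k)
  case (Suc k)
  have "p dvd (p choose Suc k)"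
    using Suc.prems p by (intro dvd_choose_prime) auto
  then obtain c where c: "p choose Suc k = p * c"
    by auto
  have "p choose Suc k = ((p - 1) choose k) + ((p - 1) choose Suc k)"
    using Suc.prems binomial_Suc_Suc[of "p - 1" k] by simp
  then have "of_nat ((p - 1) choose Suc k) =
      (of_nat p * of_nat c - of_nat ((p - 1) choose k) :: rat)"
    using c by (metis add_diff_cancel_left' of_nat_add of_nat_mult)
  moreover have "pcong p (of_nat p) (of_nat p * of_nat c) 0"
    by (intro pcongI[of _ _ "of_nat c"] p_integral_intros) simp_all
  then have "pcong p (of_nat p) (of_nat p * of_nat c - of_nat ((p - 1) choose k)) (0 - (- 1) ^ k)"
    using Suc by (intro pcong_diff) auto
  ultimately show ?case
    by simp
qed (auto intro: pcong_refl p_integral_1)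

text \<open>Row \<open>p\<close> sums to \<open>2 ^ p\<close>, and its two end entries account for
  the 2. Absorption turns each inner entry divided by \<open>p\<close> into an entry of row
  \<open>p - 1\<close> divided by \<open>k\<close>.\<close>

lemma fermat_quotient_alternating_sum:
  "pcong p (of_nat p) ((2 ^ p - 2) / of_nat p) (\<Sum>k = 1..p - 1. (- 1) ^ (k - 1) / of_nat k)"
proof -
  have p0: "p > 0"
    using p prime_gt_0_nat by blast
  have "(2 :: nat) ^ p = (\<Sum>k\<le>p. p choose k)"
    by (simp add: choose_row_sum)
  also have "{..p} = insert 0 (insert p {1..p - 1})"
    using p0 by auto
  also have "(\<Sum>k\<in>\<dots>. p choose k) = 2 + (\<Sum>k = 1..p - 1. p choose k)"
    using p0 by (subst sum.insert; simp)+
  finally have "(2 ^ p :: rat) = 2 + (\<Sum>k = 1..p - 1. of_nat (p choose k))"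
    by (metis of_nat_add of_nat_numeral of_nat_power of_nat_sum)
  then have "(2 ^ p - 2) / of_nat p = (\<Sum>k = 1..p - 1. of_nat (p choose k) / of_nat p :: rat)"
    by (simp add: sum_divide_distrib)
  also have "\<dots> = (\<Sum>k = 1..p - 1. of_nat ((p - 1) choose (k - 1)) / of_nat k)"
  proof (intro sum.cong refl)
    fix k assume k: "k \<in> {1..p - 1}"
    then have "k * (p choose k) = p * ((p - 1) choose (k - 1))"
      by (intro times_binomial_minus1_eq) auto
    then have "(of_nat k * of_nat (p choose k) :: rat) = of_nat p * of_nat ((p - 1) choose (k - 1))"
      by (metis of_nat_mult)
    then show "of_nat (p choose k) / of_nat p = (of_nat ((p - 1) choose (k - 1)) / of_nat k :: rat)"
      using k p0 by (simp add: field_simps)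
  qed
  also have "pcong p (of_nat p) \<dots> (\<Sum>k = 1..p - 1. (- 1) ^ (k - 1) / of_nat k)"
  proof (rule pcong_sum)
    fix k assume k: "k \<in> {1..p - 1}"
    then have "\<not> p dvd k"
      by (auto dest: dvd_imp_le)
    then have "pcong p (of_nat p) (1 / of_nat k * of_nat ((p - 1) choose (k - 1)))
        (1 / of_nat k * (- 1) ^ (k - 1))"
      using k by (intro pcong_scale pcong_choose_pred p_integral_divide_nat p_integral_1) auto
    then show "pcong p (of_nat p) (of_nat ((p - 1) choose (k - 1)) / of_nat k)
        ((- 1) ^ (k - 1) / of_nat k)"
      by simp
  qed
  finally show ?thesis .
qed

text \<open>Under k -> p - k the sign flips because \<open>p\<close> is odd, and 1/(p - k) is -1/k
  modulo \<open>p\<close>. Hence the two halves of the full sum agree, and the resulting factor 2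
  cancels against 2^p - 2 = 2 (2^(p-1) - 1).\<close>

lemma fermat_quotient_half_alternating_sum:
  assumes m: "p = 2 * m + 1"
  shows "pcong p (of_nat p) ((2 ^ (p - 1) - 1) / of_nat p)
    (\<Sum>k = 1..m. (- 1) ^ (k - 1) / of_nat k)"
proof -
  let ?f = "\<lambda>k. (- 1) ^ (k - 1) / (of_nat k :: rat)"
  have nd: "\<not> p dvd k" if "k \<ge> 1" "k \<le> p - 1" for k
    using that by (auto dest: dvd_imp_le)
  have "{1..p - 1} = {1..m} \<union> {m + 1..2 * m}"
    using m by auto
  then have "sum ?f {1..p - 1} = sum ?f {1..m} + sum ?f {m + 1..2 * m}"
    by (simp add: sum.union_disjoint)
  moreover have "sum ?f {m + 1..2 * m} = (\<Sum>k = 1..m. ?f (p - k))"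
    by (rule sum.reindex_bij_witness[of _ "\<lambda>k. p - k" "\<lambda>k. p - k"]) (auto simp: m)
  moreover have "pcong p (of_nat p) (\<Sum>k = 1..m. ?f (p - k)) (sum ?f {1..m})"
  proof (rule pcong_sum)
    fix k assume k: "k \<in> {1..m}"
    have "p - k - 1 = 2 * (m - k) + Suc (k - 1)"
      using k m by auto
    then have e: "(- 1) ^ (p - k - 1) = (- ((- 1) ^ (k - 1)) :: rat)"
      by (simp add: power_add)
    \<comment> \<open>This is 1/k + 1/(p - k) = p/(k (p - k)), up to sign.\<close>
    have "?f (p - k) - ?f k = of_nat p * (- ((- 1) ^ (k - 1)) / of_nat k / of_nat (p - k))"
    proof -
      have "of_nat p = (of_nat (p - k) + of_nat k :: rat)"
        using k m by (simp flip: of_nat_add)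
      then show ?thesis
        using k m unfolding e by (simp add: divide_simps) (simp add: algebra_simps)
    qed
    moreover have "\<not> p dvd k" "\<not> p dvd p - k"
      by (rule nd; use k m in auto)+
    ultimately show "pcong p (of_nat p) (?f (p - k)) (?f k)"
      by (intro pcongI[of _ _ "- ((- 1) ^ (k - 1)) / of_nat k / of_nat (p - k)"]
            p_integral_divide_nat p_integral_minus p_integral_power p_integral_1)
  qed
  moreover have R: "sum ?f {1..m} \<in> p_integral p"
    using m by (intro p_integral_sum p_integral_divide_nat nd p_integral_power
        p_integral_minus p_integral_1) auto
  ultimately have "pcong p (of_nat p) (sum ?f {1..p - 1}) (2 * sum ?f {1..m})"
    unfolding mult_2 by (simp only: pcong_add pcong_refl)
  with fermat_quotient_alternating_sum
  have "pcong p (of_nat p) ((2 ^ p - 2) / of_nat p) (2 * sum ?f {1..m})"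
    by (rule pcong_trans)
  moreover have "\<not> p dvd 2"
    using m prime_ge_2_nat[OF p] by (auto dest: dvd_imp_le)
  ultimately have "pcong p (of_nat p) (1 / of_nat 2 * ((2 ^ p - 2) / of_nat p))
      (1 / of_nat 2 * (2 * sum ?f {1..m}))"
    by (intro pcong_scale p_integral_divide_nat p_integral_1) auto
  moreover have "(2 :: rat) ^ p = 2 * 2 ^ (p - 1)"
    using m by simp
  ultimately show ?thesis
    by (simp add: diff_divide_distrib)
qed

end

section \<open>Identities in characteristic 0\<close>

text \<open>Passing from n to n + 1 on the right gains 1/(2n+1) + 1/(2n+2) and loses 1/(n+1); the
  net change 1/(2n+1) - 1/(2n+2) is that of the left side.\<close>

lemma alternating_harmonic:
  "(\<Sum>k = 1..2 * n. (- 1) ^ (k - 1) / of_nat k)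
    = (\<Sum>j = 1..n. 1 / of_nat (n + j) :: 'a :: field_char_0)"
proof (induction n)
  case (Suc n)
  let ?h = "\<lambda>j. 1 / of_nat (n + j) :: 'a"
  have "(\<Sum>j = 1..Suc n. 1 / of_nat (Suc n + j) :: 'a) = sum ?h {Suc 1..Suc (Suc n)}"
    by (subst sum.shift_bounds_cl_Suc_ivl) simp
  also have "\<dots> = sum ?h {1..Suc (Suc n)} - ?h 1"
    by (subst (2) sum.atLeast_Suc_atMost) simp_all
  also have "\<dots> = sum ?h {1..n} + ?h (n + 1) + (?h (n + 2) - ?h 1)"
    by (simp add: ac_simps)
  also have "?h (n + 2) - ?h 1 = - ?h (n + 2)"
  proof -
    have "of_nat (n + (n + 2)) = (2 * of_nat (n + 1) :: 'a)"
      by simp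
    moreover have "1 / (2 * x) - 1 / x = - (1 / (2 * x))" for x :: 'a
      by (cases "x = 0") (simp_all add: field_simps)
    ultimately show ?thesis
      by metis
  qed
  finally show ?case
    using Suc by (simp add: mult_2 del: of_nat_add of_nat_Suc of_nat_mult)
qed auto

text \<open>Negating the upper index turns the sum into a Vandermonde convolution with upper indices
  -n - 1 and n, which add up to -1. It is the value of the Legendre polynomial of degree n at
  -1.\<close>

lemma alternating_sum_choose_choose:
  "(\<Sum>k\<le>n. (- 1) ^ k * of_nat (n choose k) * of_nat ((n + k) choose k))
    = ((- 1) ^ n :: 'a :: field_char_0)"
proof -
  have g: "(- of_nat n - 1) gchoose k = ((- 1) ^ k * of_nat ((n + k) choose k) :: 'a)" for k
    by (subst gbinomial_negated_upper) (simp add: binomial_gbinomial add.commute)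
  have "(\<Sum>k\<le>n. (- 1) ^ k * of_nat (n choose k) * of_nat ((n + k) choose k))
      = (\<Sum>k = 0..n. ((- of_nat n - 1) gchoose k) * (of_nat n gchoose (n - k)) :: 'a)"
    unfolding g
    by (intro sum.cong) (auto simp: binomial_gbinomial[symmetric] binomial_symmetric[symmetric])
  also have "\<dots> = (- 1) gchoose n"
    by (subst gbinomial_Vandermonde) simp
  also have "\<dots> = (- 1) ^ n"
    by (subst gbinomial_negated_upper) (simp add: binomial_gbinomial[symmetric])
  finally show ?thesis .
qed

text \<open>Instead of computing residues, the induction shows that the sum obeys the recurrence of
  the product: step n to n + 1 multiplies it by (n + 1 - z)/(z + n + 1).\<close>

lemma partial_fraction_choose_choose:
  fixes z :: "'a :: field_char_0"
  assumes "\<And>k. k \<le> n \<Longrightarrow> z + of_nat k \<noteq> 0"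
  shows "(\<Sum>k\<le>n. (- 1) ^ k * of_nat (n choose k) * of_nat ((n + k) choose k) / (z + of_nat k))
    = (\<Prod>j = 1..n. of_nat j - z) / (\<Prod>j\<le>n. z + of_nat j)"
  using assms
proof (induction n)
  case (Suc n)
  define c where "c m k = ((- 1) ^ k * of_nat (m choose k) * of_nat ((m + k) choose k) :: 'a)" for m k
  \<comment> \<open>Both sums run up to \<open>Suc n\<close>, so they can be combined termwise; the
    extra term of \<open>S n\<close> is 0 since \<open>n choose Suc n\<close> vanishes.\<close>
  define S where "S m = (\<Sum>k\<le>Suc n. c m k / (z + of_nat k))" for m
  have c: "of_nat (Suc n - k) * c (Suc n) k = of_nat (Suc n + k) * c n k" if "k \<le> Suc n" for k
  proof -
    have "(Suc n - k) * (Suc n choose k) = Suc n * (n choose k)"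
      using binomial_absorb_comp[of "Suc n" k] by simp
    moreover have "Suc n * (Suc (n + k) choose k) = Suc (n + k) * ((n + k) choose k)"
      using binomial_absorb_comp[of "Suc (n + k)" k] by simp
    ultimately have "(Suc n - k) * ((Suc n choose k) * ((Suc n + k) choose k))
        = (Suc n + k) * ((n choose k) * ((n + k) choose k))"
      by (metis (no_types, opaque_lifting) add_Suc mult.assoc mult.left_commute)
    then have "(of_nat (Suc n - k) * (of_nat (Suc n choose k) * of_nat ((Suc n + k) choose k)) :: 'a)
        = of_nat (Suc n + k) * (of_nat (n choose k) * of_nat ((n + k) choose k))"
      by (metis of_nat_mult)
    then show ?thesis
      unfolding c_def by (metis (no_types, lifting) mult.assoc mult.left_commute)
  qed
  \<comment> \<open>Both factors are \<open>\<plusminus> (z + k)\<close> up to a constant, and by \<open>c\<close> the constants cancel in each term,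
    so the denominators disappear from the difference.\<close>
  have "(of_nat (Suc n) + z) * S (Suc n) - (of_nat (Suc n) - z) * S n
      = (\<Sum>k\<le>Suc n. ((of_nat (Suc n) + z) * c (Suc n) k - (of_nat (Suc n) - z) * c n k) / (z + of_nat k))"
    unfolding S_def by (simp only: sum_distrib_left sum_subtractf[symmetric]
        diff_divide_distrib times_divide_eq_right)
  also have "\<dots> = (\<Sum>k\<le>Suc n. c (Suc n) k + c n k)"
  proof (intro sum.cong refl)
    fix k assume "k \<in> {..Suc n}"
    then have k: "k \<le> Suc n" by simp
    have "(of_nat (Suc n) + z) * c (Suc n) k - (of_nat (Suc n) - z) * c n k
       = (z + of_nat k) * (c (Suc n) k + c n k)
         + (of_nat (Suc n - k) * c (Suc n) k - of_nat (Suc n + k) * c n k)"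
      using k by (simp add: of_nat_diff algebra_simps)
    also have "\<dots> = (z + of_nat k) * (c (Suc n) k + c n k)"
      using c[OF k] by simp
    finally show "((of_nat (Suc n) + z) * c (Suc n) k - (of_nat (Suc n) - z) * c n k) / (z + of_nat k)
        = c (Suc n) k + c n k"
      using Suc.prems[OF k] by simp
  qed
  also have "\<dots> = (\<Sum>k\<le>Suc n. c (Suc n) k) + (\<Sum>k\<le>n. c n k)"
    by (simp add: sum.distrib c_def)
  \<comment> \<open>The two alternating sums are (-1)^(n+1) and (-1)^n.\<close>
  also have "\<dots> = 0"
    unfolding c_def alternating_sum_choose_choose by simp
  finally have "(z + of_nat (Suc n)) * S (Suc n) = (of_nat (Suc n) - z) * S n"
    by (simp add: add.commute)
  moreover have "S n = (\<Prod>j = 1..n. of_nat j - z) / (\<Prod>j\<le>n. z + of_nat j)"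
    using Suc.IH Suc.prems unfolding S_def c_def by simp
  moreover have "z + of_nat (Suc n) \<noteq> 0"
    using Suc.prems by blast
  ultimately have "S (Suc n) = (of_nat (Suc n) - z)
      * ((\<Prod>j = 1..n. of_nat j - z) / (\<Prod>j\<le>n. z + of_nat j)) / (z + of_nat (Suc n))"
    by (metis nonzero_mult_div_cancel_left)
  then have "S (Suc n) = (\<Prod>j = 1..Suc n. of_nat j - z) / (\<Prod>j\<le>Suc n. z + of_nat j)"
    by (simp add: mult.commute)
  then show ?case
    by (simp only: S_def c_def)
qed auto

text \<open>The product is (1/4)_k (3/4)_k / k!^2 with each factor of the rising factorials
  multiplied by 4. In this form single factors can be compared modulo \<open>p\<close> or split
  off.\<close>

lemma central_binomials_eq_prod:
  "of_nat ((2 * k) choose k) * of_nat ((4 * k) choose (2 * k)) / 64 ^ k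
    = (\<Prod>j<k. of_nat (4 * j + 1) * of_nat (4 * j + 3) / (16 * of_nat (j + 1) ^ 2) :: 'a :: field_char_0)"
proof -
  have "of_nat ((2 * k) choose k) * of_nat ((4 * k) choose (2 * k))
      = (fact (4 * k) / (fact (2 * k) * fact k ^ 2) :: 'a)"
    by (simp add: binomial_fact power2_eq_square)
  moreover have "fact (4 * k) / (fact (2 * k) * fact k ^ 2) / 64 ^ k
    = (\<Prod>j<k. of_nat (4 * j + 1) * of_nat (4 * j + 3) / (16 * of_nat (j + 1) ^ 2) :: 'a)"
  proof (induction k)
    case (Suc k)
    have 4: "fact (4 * Suc k) = ((of_nat (4 * k + 4)) * of_nat (4 * k + 3) * of_nat (4 * k + 2)
        * of_nat (4 * k + 1) * fact (4 * k) :: 'a)"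
      by (simp add: numeral_eq_Suc algebra_simps)
    have 2: "fact (2 * Suc k) = ((of_nat (2 * k + 2)) * of_nat (2 * k + 1) * fact (2 * k) :: 'a)"
      by (simp add: algebra_simps)
    have nz: "of_nat (2 * k + 1) \<noteq> (0 :: 'a)" "of_nat (k + 1) \<noteq> (0 :: 'a)"
      by (simp_all only: of_nat_eq_0_iff)
    \<comment> \<open>After these rewritings the even factors cancel to 4/(k+1)^2, and dividing by
      64 leaves 1/(16 (k+1)^2).\<close>
    have eqs: "of_nat (4 * k + 4) = (4 * of_nat (k + 1) :: 'a)"
        "of_nat (2 * k + 2) = (2 * of_nat (k + 1) :: 'a)"
        "of_nat (4 * k + 2) = (2 * of_nat (2 * k + 1) :: 'a)"
        "fact (Suc k) = (of_nat (k + 1) * fact k :: 'a)"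
      by (simp_all add: algebra_simps)
    have "fact (4 * Suc k) / (fact (2 * Suc k) * fact (Suc k) ^ 2) / 64 ^ Suc k
      = fact (4 * k) / (fact (2 * k) * fact k ^ 2) / 64 ^ k
        * (of_nat (4 * k + 1) * of_nat (4 * k + 3) / (16 * of_nat (k + 1) ^ 2) :: 'a)"
      using nz unfolding 4 2 eqs by (simp add: field_simps power2_eq_square del: of_nat_add of_nat_mult of_nat_Suc)
    then show ?case
      unfolding prod.lessThan_Suc Suc.IH[symmetric] .
  qed simp
  ultimately show ?thesis
    by simp
qed

section \<open>The congruence modulo \<open>p ^ 2\<close>\<close>

theorem theorem3p2:
  fixes p :: nat
  assumes "prime p" and "p mod 4 = 1"
  shows "pcong p (of_nat p ^ 2)
    (\<Sum>k = 0..p - 1. of_nat ((2 * k) choose k) * of_nat ((4 * k) choose (2 * k)) / 64 ^ k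
        * (of_nat p / of_nat (4 * k + 1)))
    ((-1) ^ ((p - 1) div 4) * ((3 - 2 ^ (p - 1)) / 2)
        * of_nat (((p - 1) div 2) choose ((p - 1) div 4)))"
proof -
  define n where "n = p div 4"
  have pn: "p = 4 * n + 1"
    using assms(2) unfolding n_def by presburger
  have p: "prime p" by fact
  have n: "n > 0"
    using p pn by (cases "n = 0") auto
  note R = p_integral_intros[OF p]
  note [trans] = pcong_trans[OF p]
  have nd_small: "\<not> p dvd k" if "0 < k" "k < p" for k
    using that by (auto dest: dvd_imp_le)
  have nd4: "\<not> p dvd 4 * k" if "0 < k" "k < p" for k
    using that p nd_small[of k] nd_small[of 4] n pn by (auto simp: prime_dvd_mult_iff)
  \<comment> \<open>The cofactor of \<open>p\<close> in 4k + 1 is below 4 and congruent to 1 modulo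
    4, so it is 1 and k = n.\<close>
  have nd41: "\<not> p dvd 4 * k + 1" if k: "k < p" "k \<noteq> n" for k
  proof
    assume "p dvd 4 * k + 1"
    then obtain q where q: "4 * k + 1 = p * q" by blast
    have "p * q < p * 4"
      using q k(1) by linarith
    then have "q < 4"
      by simp
    moreover have "q mod 4 = 1"
    proof -
      have "4 * k + 1 = 4 * (n * q) + q"
        using q pn by (simp add: algebra_simps)
      then show ?thesis
        by presburger
    qed
    ultimately have "q = 1" by simp
    then show False
      using q pn k by simp
  qed

  \<comment> \<open>Coefficients modulo \<open>p\<close>, and the terms beyond
    \<open>n\<close>\<close>
  define a where "a k = (\<Prod>j<k. of_nat (4 * j + 1) * of_nat (4 * j + 3) / (16 * of_nat (j + 1) ^ 2) :: rat)" for k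
  define c where "c k = ((- 1) ^ k * of_nat (n choose k) * of_nat ((n + k) choose k) :: rat)" for k
  have c_eq: "c k = (\<Prod>j<k. - (of_nat (n - j) * of_nat (n + 1 + j)) / of_nat (j + 1) ^ 2)" for k
  proof (induction k)
    case (Suc k)
    have "Suc k * (n choose Suc k) = (n - k) * (n choose k)"
      by (metis binomial_absorb_comp binomial_absorption times_binomial_minus1_eq)
    moreover have "Suc k * ((n + Suc k) choose Suc k) = (n + 1 + k) * ((n + k) choose k)"
      using Suc_times_binomial[of k "n + k"] by simp
    ultimately have "(of_nat (k + 1) * of_nat (n choose Suc k) :: rat) = of_nat (n - k) * of_nat (n choose k)"
      and "(of_nat (k + 1) * of_nat ((n + Suc k) choose Suc k) :: rat)
        = of_nat (n + 1 + k) * of_nat ((n + k) choose k)"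
      by (simp_all only: of_nat_mult[symmetric] Suc_eq_plus1)
    moreover have "of_nat (k + 1) ^ 2 * c (Suc k) = - ((- 1) ^ k)
        * (of_nat (k + 1) * of_nat (n choose Suc k)) * (of_nat (k + 1) * of_nat ((n + Suc k) choose Suc k))"
      unfolding c_def power2_eq_square power_Suc by (simp only: mult_minus_left mult_1 mult_ac)
    ultimately have "of_nat (k + 1) ^ 2 * c (Suc k) = - (of_nat (n - k) * of_nat (n + 1 + k)) * c k"
      unfolding c_def by (simp only: mult_minus_left mult_minus_right mult_ac)
    then have "c (Suc k) = c k * (- (of_nat (n - k) * of_nat (n + 1 + k)) / of_nat (k + 1) ^ 2)"
      by (simp add: field_simps del: of_nat_add of_nat_Suc)
    then show ?case
      unfolding prod.lessThan_Suc Suc.IH .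
  qed (simp add: c_def)

  have inv_R: "x / of_nat (j + 1) ^ 2 \<in> p_integral p" if "x \<in> p_integral p" "j + 1 < p" for x j
  proof -
    have "\<not> p dvd (j + 1) ^ 2"
      using that p nd_small by (metis prime_dvd_power zero_less_Suc Suc_eq_plus1)
    from p_integral_divide_nat[OF p that(1) this] show ?thesis
      by simp
  qed
  have factor_R: "x / (16 * of_nat (j + 1) ^ 2) \<in> p_integral p" if "x \<in> p_integral p" "j + 1 < p" for x j
  proof -
    have "\<not> p dvd 16"
      using nd4[of 4] n pn by (cases "n = 1") auto
    from p_integral_divide_nat[OF p inv_R[OF that] this] show ?thesis
      by (simp add: mult.commute)
  qed
  have a_c: "pcong p (of_nat p) (a k) (c k)" if "k \<le> n" for k
    unfolding a_def c_eq
  proof (rule pcong_prod[OF p])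
    fix j assume j: "j \<in> {..<k}"
    \<comment> \<open>Since (4j+1)(4j+3) = 16 j (j+1) + 3, the left side equals (4n+1)(4n+3) = p (p
      + 2).\<close>
    have "of_nat (4 * j + 1) * of_nat (4 * j + 3) - 16 * (- (of_nat (n - j) * of_nat (n + 1 + j)))
       = of_nat p * (of_nat p + 2 :: rat)"
      using j that by (simp add: of_nat_diff pn algebra_simps)
    then have "of_nat (4 * j + 1) * of_nat (4 * j + 3) / (16 * of_nat (j + 1) ^ 2)
        - - (of_nat (n - j) * of_nat (n + 1 + j)) / of_nat (j + 1) ^ 2
        = of_nat p * ((of_nat p + 2) / (16 * of_nat (j + 1) ^ 2) :: rat)"
      by (simp add: divide_simps del: of_nat_add of_nat_Suc)
    then show "pcong p (of_nat p) (of_nat (4 * j + 1) * of_nat (4 * j + 3) / (16 * of_nat (j + 1) ^ 2))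
        (- (of_nat (n - j) * of_nat (n + 1 + j)) / of_nat (j + 1) ^ 2)"
      using j that pn
      by (intro pcongI[OF p, of _ _ "(of_nat p + 2) / (16 * of_nat (j + 1) ^ 2)"] factor_R inv_R R) auto
  qed
  have tail: "pcong p (of_nat p ^ 2) (a k * (of_nat p / of_nat (4 * k + 1))) 0" if k: "n < k" "k < p" for k
  proof -
    let ?f = "\<lambda>j. of_nat (4 * j + 1) * of_nat (4 * j + 3) / (16 * of_nat (j + 1) ^ 2) :: rat"
    \<comment> \<open>One \<open>p\<close> is the numerator of the weight; the other is 4n + 1 in
      the factor j = n of \<open>a k\<close>. What is left, \<open>r\<close>, has all denominators
      prime to \<open>p\<close>.\<close>
    define r where "r = of_nat (4 * n + 3) / (16 * of_nat (n + 1) ^ 2)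
        * (\<Prod>j\<in>{..<k} - {n}. ?f j) / of_nat (4 * k + 1)"
    have "r \<in> p_integral p"
      unfolding r_def using k pn
      by (intro p_integral_divide_nat[OF p] factor_R nd41 R) auto
    moreover have "a k = ?f n * (\<Prod>j\<in>{..<k} - {n}. ?f j)"
      unfolding a_def using k by (intro prod.remove) auto
    then have "a k * (of_nat p / of_nat (4 * k + 1)) = of_nat p ^ 2 * r"
      unfolding r_def pn[symmetric] by (simp add: power2_eq_square del: of_nat_add)
    ultimately show ?thesis
      by (intro pcongI[OF p, of _ _ r]) (auto intro: R)
  qed

  \<comment> \<open>Rising factorials at 3/4 and 1/4\<close>
  define X where "X = (\<Prod>j = 1..n. of_nat j - 1 / 4 :: rat)"
  define Y where "Y = (\<Prod>j<n. 1 / 4 + of_nat j :: rat)"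
  define D where "D = ((- 1) ^ n * of_nat ((2 * n) choose n) :: rat)"
  define P where "P = (\<Prod>j = 1..n. 1 + of_nat p * (- 1 / of_nat (4 * (n + j))) :: rat)"
  define Q where "Q = (\<Prod>j = 1..n. 1 + of_nat p * (- 1 / of_nat (4 * j)) :: rat)"
  define s where "s = (\<Sum>j = 1..n. - 1 / of_nat (4 * (n + j)) :: rat)"
  define t where "t = (\<Sum>j = 1..n. - 1 / of_nat (4 * j) :: rat)"

  \<comment> \<open>j - 1/4 = (n + j) - p/4.\<close>
  have X: "X = (\<Prod>j = 1..n. of_nat (n + j)) * P"
    unfolding X_def P_def prod.distrib[symmetric]
    by (intro prod.cong) (auto simp: pn field_simps)
  have Y: "Y = (- 1) ^ n * fact n * Q"
  proof -
    \<comment> \<open>After this reversal each factor is p/4 - j, a unit multiple of the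
      corresponding factor of \<open>Q\<close>.\<close>
    have "Y = (\<Prod>j = 1..n. 1 / 4 + of_nat (n - j))"
      unfolding Y_def by (rule prod.reindex_bij_witness[of _ "\<lambda>j. n - j" "\<lambda>j. n - j"]) auto
    also have "\<dots> = (\<Prod>j = 1..n. (- 1) * of_nat j * (1 + of_nat p * (- 1 / of_nat (4 * j))))"
      by (intro prod.cong) (auto simp: pn field_simps of_nat_diff)
    finally show ?thesis
      unfolding Q_def fact_prod of_nat_prod prod.distrib by simp
  qed
  have "(\<Prod>j = 1..m. of_nat (n + j)) * fact n = (fact (n + m) :: rat)" for m
  proof (induction m)
    case (Suc m)
    then have "(\<Prod>j = 1..Suc m. of_nat (n + j)) * fact n = of_nat (n + Suc m) * (fact (n + m) :: rat)"
      by (simp del: of_nat_add)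
    then show ?case
      by simp
  qed simp
  from this[of n] have D: "(\<Prod>j = 1..n. of_nat (n + j)) = fact n * (of_nat ((2 * n) choose n) :: rat)"
    by (simp add: binomial_fact field_simps flip: mult_2)
  have an: "a n = X * Y / fact n ^ 2"
  proof -
    have "a n = (\<Prod>j<n. (of_nat (Suc j) - 1 / 4) * (1 / 4 + of_nat j) / of_nat (Suc j) ^ 2)"
      unfolding a_def by (intro prod.cong) (auto simp: divide_simps algebra_simps)
    moreover have "X = (\<Prod>j<n. of_nat (Suc j) - 1 / 4)"
      unfolding X_def One_nat_def by (rule prod.atLeast1_atMost_eq)
    moreover have "fact n = (\<Prod>j<n. of_nat (Suc j) :: rat)"
      unfolding fact_prod of_nat_prod One_nat_def by (rule prod.atLeast1_atMost_eq)
    ultimately show ?thesis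
      unfolding Y_def by (simp only: prod.distrib prod_dividef prod_power_distrib)
  qed
  have a_D: "a n = D * (P * Q)"
    unfolding an X Y D D_def by (simp add: power2_eq_square)
  \<comment> \<open>Over a common denominator the numerators 4j - p are seen to be prime to
    \<open>p\<close>, so \<open>Q\<close> is nonzero and its inverse is p-integral.\<close>
  have Q: "Q = (\<Prod>j = 1..n. of_int (int (4 * j) - int p) / of_nat (4 * j))"
    unfolding Q_def by (intro prod.cong) (auto simp: field_simps)
  have nd4p: "\<not> int p dvd int (4 * j) - int p" if "j \<in> {1..n}" for j
  proof -
    have "\<not> int p dvd int (4 * j)"
      using that pn nd4[of j] unfolding int_dvd_int_iff by auto
    then show ?thesis
      by (simp add: dvd_diff_left_iff)
  qed
  have Q0: "Q \<noteq> 0"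
  proof -
    have "int (4 * j) - int p \<noteq> 0" if "j \<in> {1..n}" for j
      using nd4p[OF that] by (metis dvd_0_right)
    then show ?thesis
      unfolding Q by (subst prod_zero_iff) (simp_all only: finite_atLeastAtMost
        divide_eq_0_iff of_int_eq_0_iff of_nat_eq_0_iff, auto)
  qed
  have "1 / Q = (\<Prod>j = 1..n. of_nat (4 * j) / of_int (int (4 * j) - int p))"
    unfolding Q by (simp only: prod_dividef) simp
  moreover have "\<dots> \<in> p_integral p"
    by (intro p_integral_divide_int[OF p] nd4p R)
  ultimately have invQ: "1 / Q \<in> p_integral p"
    by simp
  have X_D: "X / Y = D * (P / Q)"
    unfolding X Y D D_def by (simp add: minus_one_power_iff)

  \<comment> \<open>Evaluation of the sum over \<open>c\<close> at z = 1/4\<close>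
  have "(\<Sum>k\<le>n. c k / (1 / 4 + of_nat k)) = X / (\<Prod>j\<le>n. 1 / 4 + of_nat j)"
    unfolding c_def X_def by (intro partial_fraction_choose_choose) (auto simp: add_eq_0_iff)
  \<comment> \<open>The last factor is 1/4 + n = p/4; multiplying by it turns 1/(1/4 + k) into the
    weight p/(4k+1).\<close>
  also have "(\<Prod>j\<le>n. 1 / 4 + of_nat j :: rat) = Y * (of_nat p / 4)"
    unfolding Y_def lessThan_Suc_atMost[symmetric] by (simp add: pn field_simps)
  finally have "(\<Sum>k\<le>n. c k / (1 / 4 + of_nat k)) * (of_nat p / 4) = X / Y"
    using pn by simp
  also have "(\<Sum>k\<le>n. c k / (1 / 4 + of_nat k)) * (of_nat p / 4)
      = (\<Sum>k\<le>n. c k * (of_nat p / of_nat (4 * k + 1)))"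
    unfolding sum_distrib_right by (intro sum.cong) (auto simp: field_simps)
  \<comment> \<open>At k = n the weight is 1 and \<open>c n\<close> is \<open>D\<close>.\<close>
  also have "\<dots> = (\<Sum>k<n. c k * (of_nat p / of_nat (4 * k + 1))) + D"
    unfolding lessThan_Suc_atMost[symmetric]
    by (simp add: c_def D_def pn mult_2 add_divide_distrib del: of_nat_add of_nat_mult of_nat_Suc)
  finally have c_sum: "(\<Sum>k<n. c k * (of_nat p / of_nat (4 * k + 1))) = D * (P / Q) - D"
    unfolding X_D by simp

  \<comment> \<open>First-order expansion in \<open>p\<close>\<close>
  have st: "s \<in> p_integral p" "t \<in> p_integral p"
    unfolding s_def t_def using pn by (intro p_integral_divide_nat[OF p] nd4 R; auto)+
  have DPR: "D \<in> p_integral p" "P \<in> p_integral p" "Q \<in> p_integral p"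
    unfolding D_def P_def Q_def using pn
    by (intro p_integral_divide_nat[OF p] nd4 R; auto)+
  have Ps: "pcong p (of_nat p ^ 2) P (1 + of_nat p * s)"
    unfolding P_def s_def using pn by (intro prod_one_plus_p[OF p] p_integral_divide_nat[OF p] nd4 R) auto
  have Qt: "pcong p (of_nat p ^ 2) Q (1 + of_nat p * t)"
    unfolding Q_def t_def using pn by (intro prod_one_plus_p[OF p] p_integral_divide_nat[OF p] nd4 R) auto
  have invQt: "pcong p (of_nat p ^ 2) (1 / Q) (1 - of_nat p * t)"
  proof -
    have "pcong p (of_nat p ^ 2) (Q * (1 - of_nat p * t)) ((1 + of_nat p * t) * (1 - of_nat p * t))"
      using st by (intro pcong_mult[OF p] Qt pcong_refl[OF p] R)
    also have "pcong p (of_nat p ^ 2) \<dots> 1"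
    proof (rule pcongI[OF p, of _ _ "- (t * t)"])
      show "(1 + of_nat p * t) * (1 - of_nat p * t) - 1 = of_nat p ^ 2 * - (t * t)"
        by (simp add: algebra_simps power2_eq_square)
    qed (use st in \<open>auto intro: R\<close>)
    finally have "pcong p (of_nat p ^ 2) (1 / Q * (Q * (1 - of_nat p * t))) (1 / Q * 1)"
      by (intro pcong_scale[OF p] invQ)
    then show ?thesis
      using Q0 pcong_sym[OF p] by simp
  qed
  \<comment> \<open>\<open>1 / Q\<close> and \<open>Q\<close> contribute opposite multiples of
    \<open>t\<close>, so only \<open>s\<close> survives.\<close>
  have "pcong p (of_nat p ^ 2) (P * (1 / Q) + P * Q - 1)
      ((1 + of_nat p * s) * (1 - of_nat p * t) + (1 + of_nat p * s) * (1 + of_nat p * t) - 1)"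
    by (intro pcong_add[OF p] pcong_diff[OF p] pcong_mult[OF p] Ps Qt invQt pcong_refl[OF p] R)
  then have PQ: "pcong p (of_nat p ^ 2) (P / Q + P * Q - 1) (1 + of_nat p * (2 * s))"
    by (simp add: algebra_simps)

  \<comment> \<open>From the harmonic sum to the Fermat quotient\<close>
  define q where "q = ((2 ^ (p - 1) - 1) / of_nat p :: rat)"
  have "p = 2 * (2 * n) + 1"
    using pn by simp
  from fermat_quotient_half_alternating_sum[OF p this]
  have "pcong p (of_nat p) q (\<Sum>j = 1..n. 1 / of_nat (n + j))"
    unfolding q_def alternating_harmonic .
  moreover have half_R: "- 1 / of_nat 2 \<in> p_integral p"
    using nd_small[of 2] pn n by (intro p_integral_divide_nat[OF p] R) auto
  ultimately have "pcong p (of_nat p) (- 1 / of_nat 2 * q)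
      (- 1 / of_nat 2 * (\<Sum>j = 1..n. 1 / of_nat (n + j)))"
    by (intro pcong_scale[OF p])
  \<comment> \<open>\<open>s\<close> carries the factor -1/4, hence 2 \<open>s\<close> carries
    -1/2.\<close>
  moreover have "- 1 / of_nat 2 * (\<Sum>j = 1..n. 1 / of_nat (n + j)) = 2 * s"
    unfolding s_def sum_distrib_left by (intro sum.cong) (auto simp: divide_simps)
  ultimately have "pcong p (of_nat p ^ 2) (of_nat p * (2 * s)) (of_nat p * (- 1 / of_nat 2 * q))"
    using pcong_p_square[OF p] pcong_sym[OF p] by metis
  then have "pcong p (of_nat p ^ 2) (1 + of_nat p * (2 * s)) (1 + of_nat p * (- 1 / of_nat 2 * q))"
    by (intro pcong_add[OF p] pcong_refl[OF p] R)
  moreover have "1 + of_nat p * (- 1 / of_nat 2 * q) = (3 - 2 ^ (p - 1)) / 2"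
    using pn unfolding q_def by (simp add: field_simps)
  ultimately have sq: "pcong p (of_nat p ^ 2) (1 + of_nat p * (2 * s)) ((3 - 2 ^ (p - 1)) / 2)"
    by (simp only:)

  \<comment> \<open>Assembling the sum\<close>
  define w where "w k = (of_nat p / of_nat (4 * k + 1) :: rat)" for k
  have head: "pcong p (of_nat p ^ 2) (\<Sum>k<n. a k * w k) (\<Sum>k<n. c k * w k)"
  proof (rule pcong_sum[OF p])
    fix k assume k: "k \<in> {..<n}"
    have "1 / of_nat (4 * k + 1) \<in> p_integral p"
      using k pn by (intro p_integral_divide_nat[OF p] nd41 R) auto
    then have "pcong p (of_nat p ^ 2) (of_nat p * (1 / of_nat (4 * k + 1) * a k))
        (of_nat p * (1 / of_nat (4 * k + 1) * c k))"
      using k by (intro pcong_p_square[OF p] pcong_scale[OF p] a_c) auto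
    then show "pcong p (of_nat p ^ 2) (a k * w k) (c k * w k)"
      unfolding w_def by (simp add: mult_ac del: of_nat_add of_nat_mult)
  qed
  have "{0..p - 1} = {..<n} \<union> {n} \<union> {n<..<p}" "{..<n} \<inter> {n<..<p} = {}"
    using pn by auto
  then have "(\<Sum>k = 0..p - 1. a k * w k) = (\<Sum>k<n. a k * w k) + a n * w n + (\<Sum>k\<in>{n<..<p}. a k * w k)"
    by (simp add: sum.union_disjoint)
  also have "w n = 1"
    \<comment> \<open>The middle weight has no factor \<open>p\<close>, so \<open>a n\<close> must
      be known modulo \<open>p ^ 2\<close>; the exact formula \<open>a_D\<close> supplies
      it.\<close>
    unfolding w_def using pn by simp
  also have "pcong p (of_nat p ^ 2) ((\<Sum>k<n. a k * w k) + a n * 1 + (\<Sum>k\<in>{n<..<p}. a k * w k))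
      ((\<Sum>k<n. c k * w k) + D * (P * Q) + (\<Sum>k\<in>{n<..<p}. 0))"
    unfolding mult_1_right
  proof (intro pcong_add[OF p] head)
    show "pcong p (of_nat p ^ 2) (a n) (D * (P * Q))"
      unfolding a_D by (intro pcong_refl[OF p] DPR R)
    show "pcong p (of_nat p ^ 2) (\<Sum>k\<in>{n<..<p}. a k * w k) (\<Sum>k\<in>{n<..<p}. 0)"
      unfolding w_def by (intro pcong_sum[OF p] tail) auto
  qed
  also have "(\<Sum>k<n. c k * w k) + D * (P * Q) + (\<Sum>k\<in>{n<..<p}. 0) = D * (P / Q + P * Q - 1)"
    unfolding w_def c_sum by (simp add: algebra_simps)
  also have "pcong p (of_nat p ^ 2) \<dots> (D * ((3 - 2 ^ (p - 1)) / 2))"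
    by (intro pcong_scale[OF p] pcong_trans[OF p PQ sq] DPR)
  also have "D * ((3 - 2 ^ (p - 1)) / 2) = (- 1) ^ ((p - 1) div 4) * ((3 - 2 ^ (p - 1)) / 2)
      * of_nat (((p - 1) div 2) choose ((p - 1) div 4))"
    unfolding D_def by (simp add: pn)
  finally show ?thesis
    unfolding a_def w_def central_binomials_eq_prod[symmetric] .
qed

end
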